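(* For every integer $m \ge 0$, the limit $R_m(\Omega SU(2)) = \lim_{n\to\infty} R_m(X_n)$ exists and is given by $$R_m(\Omega SU(2)) = \frac{(-1)^m\, S_m\,(1 - e^{w_m\cdot\alpha_1})}{\prod_{\alpha\in\triangle^+}(1-e^{\alpha})},$$ where $\triangle^+$ is the set of all positive roots (real and imaginary) of the affine Lie algebra $\hat{\mathfrak{sl}}_2$.
   Context: Let $\alpha_0,\alpha_1$ be the simple roots of $\hat{\mathfrak{sl}}_2$ and $\delta=\alpha_0+\alpha_1$. The affine Weyl group $\overline W$ is the infinite dihedral group generated by the involutions $s_0,s_1$, acting linearly on $\mathbb{Z}\alpha_0\oplus\mathbb{Z}\alpha_1$ by $s_i\alpha_i=-\alpha_i$, $s_0\alpha_1=\alpha_1+2\alpha_0$, $s_1\alpha_0=\alpha_0+2\alpha_1$ (so $\delta$ is fixed). Let $W=\{e,s_1\}$. The positive roots are $\triangle^+=\{\alpha_1\}\cup\{\pm\alpha_1+n\delta : n\ge 1\}\cup\{n\delta:n\ge 1\}$. For $\beta\in\mathbb{Z}\alpha_0\oplus\mathbb{Z}\alpha_1$ let $e^\beta$ be the corresponding formal exponential, $e^{\beta}e^{\beta'}=e^{\beta+\beta'}$. Put $w_0=e$, $w_1=s_0$, $w_2=s_1s_0$, $w_3=s_0s_1s_0,\dots$: $w_n$ is the alternating word of length $n$ ending (on the right) in $s_0$. These are the minimal length representatives of the cosets $\overline W/W$ and index the $(T\times S^1)$-fixed points of $\Omega SU(2)$ (polynomial based loops), which is filtered by the Schubert varieties $X_n=X_{w_n}$.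 For a reduced word $w=s_{i_1}\cdots s_{i_n}$ define $S_w=\prod_{j=1}^n e^{s_{i_1}\cdots s_{i_{j-1}}(\alpha_{i_j})}$, and put $S_m=S_{w_m}$ ($S_0=1$). For a reduced word $w=s_{i_1}\cdots s_{i_n}$ and $v\in\overline W$ define $$\overline{b_{w,v}}=\sum_{\varepsilon}\ \prod_{j=1}^n\Bigl(1-e^{s_{i_1}^{\varepsilon_1}\cdots s_{i_j}^{\varepsilon_j}\alpha_{i_j}}\Bigr)^{-1},$$ the sum being over all $\varepsilon\in\{0,1\}^n$ with $s_{i_1}^{\varepsilon_1}\cdots s_{i_n}^{\varepsilon_n}=v$. The rational function attached to the fixed point $w_m$ in the localization (Atiyah-Bott type) formula for the Schubert variety $X_n$ is $$R_m(X_n)=\sum_{v'\in w_mW}\overline{b_{w_n,v'}}.$$ The function $R_m(\Omega SU(2))$ appearing in the localization formula for $\Omega SU(2)$ is the limit of $R_m(X_n)$ as $n\to\infty$, where rational functions are expanded as formal power series in $\mathbb{Z}[[e^{\alpha_0},e^{\alpha_1}]]$ (with $(1-e^{-\beta})^{-1}=-e^{\beta}(1-e^{\beta})^{-1}$ for $\beta$ a positive root) and the limit is coefficientwise. *)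

theory Defs
  imports "HOL-Computational_Algebra.Computational_Algebra" "HOL-Library.Product_Plus"
begin

text \<open>The pair \<open>(a, b)\<close> stands for \<open>a \<alpha>\<^sub>0 + b \<alpha>\<^sub>1\<close>.\<close>

type_synonym root_lattice = "int \<times> int"

datatype node = I0 | I1

fun simple_root :: "node \<Rightarrow> root_lattice" where
  "simple_root I0 = (1, 0)"
| "simple_root I1 = (0, 1)"

definition delta :: root_lattice where
  "delta = simple_root I0 + simple_root I1"

definition smul :: "int \<Rightarrow> root_lattice \<Rightarrow> root_lattice" where
  "smul k \<beta> = (k * fst \<beta>, k * snd \<beta>)"

definition pos_roots :: "root_lattice set" where
  "pos_roots = {simple_root I1}
     \<union> {simple_root I1 + smul n delta | n. n \<ge> 1}
     \<union> {- simple_root I1 + smul n delta | n. n \<ge> 1}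
     \<union> {smul n delta | n. n \<ge> 1}"

text \<open>The linear extension of \<open>s\<^sub>i \<alpha>\<^sub>i = - \<alpha>\<^sub>i\<close>, \<open>s\<^sub>0 \<alpha>\<^sub>1 = \<alpha>\<^sub>1 + 2 \<alpha>\<^sub>0\<close>,
  \<open>s\<^sub>1 \<alpha>\<^sub>0 = \<alpha>\<^sub>0 + 2 \<alpha>\<^sub>1\<close>; see \<open>refl_simple_root\<close> and \<open>refl_add\<close> below.\<close>

fun refl :: "node \<Rightarrow> root_lattice \<Rightarrow> root_lattice" where
  "refl I0 (a, b) = (2 * b - a, b)"
| "refl I1 (a, b) = (a, 2 * a - b)"

text \<open>Elements of the affine Weyl group are represented by the operators through which they act
  on the root lattice. This loses nothing: the \<open>s\<^sub>i\<close> are involutions and \<open>s\<^sub>0 s\<^sub>1\<close> has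
  infinite order (\<open>refl_involution\<close>, \<open>refl_infinite_order\<close>), so the action of the infinite
  dihedral group is faithful.\<close>

type_synonym weyl = "root_lattice \<Rightarrow> root_lattice"

definition word_prod :: "node list \<Rightarrow> weyl" where
  "word_prod w = foldr (\<lambda>i f. refl i \<circ> f) w id"

text \<open>\<open>s\<^bsub>i\<^sub>1\<^esub>\<^bsup>\<epsilon>\<^sub>1\<^esup> \<cdots> s\<^bsub>i\<^sub>n\<^esub>\<^bsup>\<epsilon>\<^sub>n\<^esup>\<close>, with \<open>True\<close>
  for the exponent 1 and \<open>False\<close> for the exponent 0.\<close>

definition subword_prod :: "node list \<Rightarrow> bool list \<Rightarrow> weyl" where
  "subword_prod w \<epsilon> = foldr (\<lambda>(i, e) f. (if e then refl i else id) \<circ> f) (zip w \<epsilon>) id"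

definition finite_weyl :: "weyl set" where
  "finite_weyl = {id, refl I1}"

definition left_coset :: "weyl \<Rightarrow> weyl set" where
  "left_coset u = (\<lambda>x. u \<circ> x) ` finite_weyl"

text \<open>The reduced word of \<open>w\<^sub>n\<close>: \<open>[]\<close>, \<open>[I0]\<close>, \<open>[I1, I0]\<close>, \<open>[I0, I1, I0]\<close>, and so on.\<close>

fun alt_word :: "nat \<Rightarrow> node list" where
  "alt_word 0 = []"
| "alt_word (Suc n) = (if even n then I0 else I1) # alt_word n"


text \<open>Rational functions in \<open>e\<^bsup>\<alpha>\<^sub>0\<^esup>\<close> (the outer polynomial variable) and
  \<open>e\<^bsup>\<alpha>\<^sub>1\<^esup>\<close> (the inner one). Likewise \<open>series\<close> is
  the ring of formal power series in these variables, with \<open>fps_nth (fps_nth F i) j\<close> the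
  coefficient of \<open>e\<^bsup>i \<alpha>\<^sub>0 + j \<alpha>\<^sub>1\<^esup>\<close>.\<close>

type_synonym ratfun = "int poly poly fract"
type_synonym series = "int fps fps"

definition fexp :: "root_lattice \<Rightarrow> ratfun" where
  "fexp \<beta> = Fract [:0, 1:] 1 powi (fst \<beta>) * Fract [:[:0, 1:]:] 1 powi (snd \<beta>)"

definition S :: "node list \<Rightarrow> ratfun" where
  "S w = (\<Prod>j<length w. fexp (word_prod (take j w) (simple_root (w ! j))))"

definition b_bar :: "node list \<Rightarrow> weyl \<Rightarrow> ratfun" where
  "b_bar w v = (\<Sum>\<epsilon> | length \<epsilon> = length w \<and> subword_prod w \<epsilon> = v.
     \<Prod>j<length w.
       inverse (1 - fexp (subword_prod (take (Suc j) w) (take (Suc j) \<epsilon>) (simple_root (w ! j)))))"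

text \<open>\<open>R m n\<close> is the function \<open>R\<^sub>m(X\<^sub>n)\<close>.\<close>

definition R :: "nat \<Rightarrow> nat \<Rightarrow> ratfun" where
  "R m n = (\<Sum>v \<in> left_coset (word_prod (alt_word m)). b_bar (alt_word n) v)"


definition series_of_poly :: "int poly poly \<Rightarrow> series" where
  "series_of_poly p = fps_of_poly (map_poly fps_of_poly p)"

text \<open>\<open>F\<close> is the power series expansion of \<open>r\<close>. There is at most one
  (\<open>expands_to_unique\<close>), and for a positive root \<open>\<beta>\<close> the expansion of
  \<open>inverse (1 - fexp (- \<beta>))\<close> is that of \<open>- fexp \<beta> / (1 - fexp \<beta>)\<close>, since these
  are the same rational function.\<close>

definition expands_to :: "ratfun \<Rightarrow> series \<Rightarrow> bool" where
  "expands_to r F \<longleftrightarrow>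
     (\<exists>p q. q \<noteq> 0 \<and> r = Fract p q \<and> F * series_of_poly q = series_of_poly p)"

text \<open>The expansions of the \<open>r x\<close> converge coefficientwise to \<open>L\<close> along the filter \<open>\<F>\<close>.
  Coefficients are integers, so each one has to be eventually constant. (The topology of the
  library on \<open>int fps fps\<close> is not this one: it is discrete in the inner variable.)\<close>

definition has_series_limit :: "('i \<Rightarrow> ratfun) \<Rightarrow> series \<Rightarrow> 'i filter \<Rightarrow> bool" where
  "has_series_limit r L \<F> \<longleftrightarrow>
     (\<exists>F. (\<forall>\<^sub>F x in \<F>. expands_to (r x) (F x)) \<and>
          (\<forall>i j. \<forall>\<^sub>F x in \<F>. fps_nth (fps_nth (F x) i) j = fps_nth (fps_nth L i) j))"


lemma refl_simple_root:
  "refl i (simple_root i) = - simple_root i"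
  "refl I0 (simple_root I1) = simple_root I1 + smul 2 (simple_root I0)"
  "refl I1 (simple_root I0) = simple_root I0 + smul 2 (simple_root I1)"
  by (cases i; simp add: smul_def)+

lemma refl_add: "refl i (\<beta> + \<gamma>) = refl i \<beta> + refl i \<gamma>"
  by (cases i; cases \<beta>; cases \<gamma>) (simp_all add: algebra_simps)

lemma refl_involution: "refl i \<circ> refl i = id"
proof
  fix \<beta> show "(refl i \<circ> refl i) \<beta> = id \<beta>"
    by (cases i; cases \<beta>) simp_all
qed

lemma refl_infinite_order:
  assumes "k > 0"
  shows "((refl I0 \<circ> refl I1) ^^ k) \<noteq> id"
proof -
  have "((refl I0 \<circ> refl I1) ^^ k) (0, 1) = (- 2 * int k, 1 - 2 * int k)"
    by (induction k) (simp_all add: algebra_simps)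
  with assms show ?thesis
    by auto
qed

lemma series_of_poly_mult: "series_of_poly (p * q) = series_of_poly p * series_of_poly q"
  unfolding series_of_poly_def
  by (rule fps_ext)
     (simp add: coeff_map_poly coeff_mult fps_mult_nth fps_of_poly_sum fps_of_poly_mult atLeast0AtMost)

lemma series_of_poly_eq_0_iff: "series_of_poly p = 0 \<longleftrightarrow> p = 0"
proof
  assume "series_of_poly p = 0"
  then have "fps_of_poly (coeff p i) = 0" for i
    by (metis series_of_poly_def coeff_map_poly fps_of_poly_0 fps_of_poly_nth fps_zero_nth)
  then show "p = 0"
    by (simp add: poly_eq_iff)
qed (simp add: series_of_poly_def)

lemma expands_to_unique:
  assumes "expands_to r F" "expands_to r G"
  shows "F = G"
proof -
  obtain p q p' q' where *: "q \<noteq> 0" "r = Fract p q" "F * series_of_poly q = series_of_poly p"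
    "q' \<noteq> 0" "r = Fract p' q'" "G * series_of_poly q' = series_of_poly p'"
    using assms unfolding expands_to_def by blast
  then have "p * q' = p' * q"
    by (simp add: eq_fract)
  then have "series_of_poly p * series_of_poly q' = series_of_poly p' * series_of_poly q"
    by (simp flip: series_of_poly_mult)
  then have "F * (series_of_poly q * series_of_poly q') = G * (series_of_poly q * series_of_poly q')"
    by (simp flip: *(3) *(6) add: mult_ac)
  with * show ?thesis
    by (simp add: series_of_poly_eq_0_iff)
qed

end

theory Submission
  imports Defs
begin

text \<open>
  The cosets \<open>w\<^sub>m W\<close> are indexed by integers \<open>k\<close> so that \<open>s\<^sub>0\<close> and \<open>s\<^sub>1\<close> act by
  \<open>k \<mapsto> 1 - k\<close> and \<open>k \<mapsto> - k\<close>, and \<open>X\<^sub>n\<close> contains exactly the fixed points in an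
  interval \<open>[a, b]\<close> with \<open>b - a = n\<close>. With \<open>q = e\<^sup>\<delta>\<close> the function attached to \<open>k\<close> has the
  closed form
  \<open>binom(n, k - a)\<^sub>q \<cdot> \<Prod>\<^sub>j 1 / (1 - e\<^bsup>\<beta>(k,j)\<^esup>)\<close>, where \<open>j\<close> ranges over
  \<open>[a, b] - {k}\<close> and \<open>\<beta>(k,j)\<close> is \<open>(k + j) \<delta> - \<alpha>\<^sub>1\<close> for \<open>j > k\<close> and its negative for \<open>j < k\<close>.
  This follows by induction on \<open>n\<close>: splitting off the first letter of the word gives a recursion
  of Demazure type, which for the closed form reduces to the \<open>q\<close>-Pascal rules.
  Exactly \<open>m\<close> of the roots \<open>\<beta>(k,j)\<close> are negative; rewriting their factors in terms of positive
  roots produces \<open>(-1)\<^sup>m S\<^sub>m\<close>. As \<open>n\<close> grows, the \<open>q\<close>-binomial coefficient converges to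
  \<open>\<Prod>\<^sub>i 1 / (1 - e\<^bsup>i\<delta>\<^esup>)\<close>, and the \<open>\<plusminus> \<beta>(k,j)\<close> exhaust the positive real roots except
  \<open>w\<^sub>m \<alpha>\<^sub>1\<close>, which would correspond to \<open>j = k\<close>.
\<close>

subsection \<open>Exponentials and Gaussian binomial coefficients\<close>

lemma fexp_int_int: "fexp (int a, int b) = Fract (monom (monom 1 b) a) 1"
proof -
  have "Fract p 1 ^ n = Fract (p ^ n) (1 :: int poly poly)" for p n
    by (induction n) (simp_all add: One_fract_def)
  moreover have "[:0, 1:] ^ a * [:[:0, 1:]:] ^ b = monom (monom (1 :: int) b) a"
    by (simp add: monom_altdef poly_const_pow mult.commute)
  ultimately show ?thesis
    by (simp add: fexp_def)
qed

lemma fexp_0 [simp]: "fexp 0 = 1"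
  by (simp add: fexp_def)

lemma fexp_add: "fexp (\<beta> + \<gamma>) = fexp \<beta> * fexp \<gamma>"
proof -
  have "Fract [:0, 1:] 1 \<noteq> (0 :: ratfun)" "Fract [:[:0, 1:]:] 1 \<noteq> (0 :: ratfun)"
    by (simp_all add: Zero_fract_def eq_fract)
  then show ?thesis
    by (simp add: fexp_def power_int_add mult_ac)
qed

lemma fexp_minus: "fexp (- \<beta>) = inverse (fexp \<beta>)"
  by (metis add.right_inverse fexp_0 fexp_add inverse_unique)

lemma fexp_nonzero [simp]: "fexp \<beta> \<noteq> 0"
  by (metis add.right_inverse fexp_0 fexp_add mult_zero_left zero_neq_one)

lemma fexp_sum: "fexp (\<Sum>i\<in>I. f i) = (\<Prod>i\<in>I. fexp (f i))"
  by (induction I rule: infinite_finite_induct) (simp_all add: fexp_add)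

lemma fexp_eq_1_iff [simp]: "fexp \<beta> = 1 \<longleftrightarrow> \<beta> = 0"
proof
  assume *: "fexp \<beta> = 1"
  obtain a b where \<beta>: "\<beta> = (a, b)" by (cases \<beta>)
  \<comment> \<open>Adding the negative parts of \<open>a\<close> and \<open>b\<close> makes all
    exponents natural numbers, so that two monomials can be compared.\<close>
  have "fexp (int (nat a), int (nat b)) = fexp (\<beta> + (int (nat (- a)), int (nat (- b))))"
    by (rule arg_cong[of _ _ fexp]) (simp add: \<beta>)
  also have "\<dots> = fexp (int (nat (- a)), int (nat (- b)))"
    by (simp add: fexp_add *)
  finally have "monom (monom (1::int) (nat b)) (nat a) = monom (monom 1 (nat (- b))) (nat (- a))"
    by (simp only: fexp_int_int eq_fract(1)[OF one_neq_zero one_neq_zero] mult_1_right)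
  then have "nat a = nat (- a)" "monom (1::int) (nat b) = monom 1 (nat (- b))"
    by (metis degree_monom_eq monom_eq_0_iff one_neq_zero, metis lead_coeff_monom)
  moreover from this have "nat b = nat (- b)"
    by (metis degree_monom_eq one_neq_zero)
  ultimately have "a = 0" "b = 0"
    by arith+
  then show "\<beta> = 0"
    by (simp add: \<beta> zero_prod_def)
qed simp

lemma smul_delta: "smul k delta = (k, k)"
  by (simp add: smul_def delta_def)

lemma fexp_smul_delta: "fexp (int n, int n) = fexp delta ^ n"
proof (induction n)
  case (Suc n)
  have "(int (Suc n), int (Suc n)) = delta + (int n, int n)"
    by (simp add: delta_def)
  then show ?case
    using Suc by (simp add: fexp_add del: of_nat_Suc)
qed (simp flip: zero_prod_def)

text \<open>The q-Pochhammer symbol (q;q)_n. The powers of 1 - q that separate it from the usual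
  q-factorial cancel in Gaussian binomials.\<close>

definition qfact :: "'a::comm_ring_1 \<Rightarrow> nat \<Rightarrow> 'a" where
  "qfact q n = (\<Prod>i=1..n. 1 - q ^ i)"

lemma qfact_simps [simp]:
  "qfact q 0 = 1"
  "qfact q (Suc n) = qfact q n * (1 - q ^ Suc n)"
  by (simp_all add: qfact_def)

text \<open>The Gaussian binomial of \<open>a + b\<close> over \<open>a\<close>, parametrized by
  both parts because a point of an interval has \<open>a\<close> points to its left and
  \<open>b\<close> to its right.\<close>

definition qbinom :: "'a::field \<Rightarrow> nat \<Rightarrow> nat \<Rightarrow> 'a" where
  "qbinom q a b = qfact q (a + b) / (qfact q a * qfact q b)"

lemma qbinom_commute: "qbinom q a b = qbinom q b a"
  by (simp add: qbinom_def ac_simps)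

lemma qfact_nonzero:
  fixes q :: "'a::idom"
  assumes "\<And>n. n > 0 \<Longrightarrow> q ^ n \<noteq> 1"
  shows "qfact q n \<noteq> 0"
  using assms by (auto simp: qfact_def)

text \<open>Comparing the coefficients of \<open>v\<close> gives the two \<open>q\<close>-Pascal rules.\<close>

lemma qbinom_pascal:
  fixes q v :: "'a::field"
  assumes "\<And>n. n > 0 \<Longrightarrow> q ^ n \<noteq> 1"
  shows "(1 - v) * qbinom q (Suc a) (Suc b) =
    (1 - v * q ^ Suc a) * qbinom q (Suc a) b - (v - q ^ Suc b) * qbinom q a (Suc b)"
proof -
  define A B C where "A = qfact q a" and "B = qfact q b" and "C = qfact q (Suc (a + b))"
  define x y where "x = q ^ Suc a" and "y = q ^ Suc b"
  have nz: "A \<noteq> 0" "B \<noteq> 0" "1 - x \<noteq> 0" "1 - y \<noteq> 0"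
    using assms[of "Suc a"] assms[of "Suc b"] qfact_nonzero[OF assms]
    by (auto simp: A_def B_def x_def y_def simp del: power_Suc)
  have xy: "q ^ Suc (Suc (a + b)) = x * y"
    by (simp add: x_def y_def power_add mult_ac)
  have 1: "qbinom q (Suc a) (Suc b) = C * (1 - x * y) / (A * (1 - x) * (B * (1 - y)))"
    by (simp add: qbinom_def A_def B_def C_def del: power_Suc flip: x_def y_def xy)
  have 2: "qbinom q (Suc a) b = C / (A * (1 - x) * B)"
    unfolding qbinom_def A_def B_def C_def x_def by simp
  have 3: "qbinom q a (Suc b) = C / (A * (B * (1 - y)))"
    unfolding qbinom_def A_def B_def C_def y_def by simp
  show ?thesis
    unfolding 1 2 3 x_def[symmetric] y_def[symmetric]
    using nz by (simp add: divide_simps) (simp add: algebra_simps)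
qed

subsection \<open>Recursion for the localization functions\<close>

text \<open>The recursion applies \<open>s\<^sub>i\<close> to rational functions. Carrying an operator \<open>u\<close> on the exponents
  along instead avoids extending the lattice automorphisms to the field of rational functions.\<close>

definition lattice_embedding :: "(root_lattice \<Rightarrow> root_lattice) \<Rightarrow> bool" where
  "lattice_embedding u \<longleftrightarrow>
     (\<forall>\<beta> \<gamma>. u (\<beta> + \<gamma>) = u \<beta> + u \<gamma>) \<and> inj u \<and> u delta = delta"

context
  fixes u assumes u: "lattice_embedding u"
begin

lemma embedding_add: "u (\<beta> + \<gamma>) = u \<beta> + u \<gamma>"
  using u unfolding lattice_embedding_def by blast

lemma embedding_0 [simp]: "u 0 = 0"
  using embedding_add[of 0 0] by simp

lemma embedding_minus: "u (- \<beta>) = - u \<beta>"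
  using embedding_add[of \<beta> "- \<beta>"] by (simp add: eq_neg_iff_add_eq_0 add.commute)

lemma embedding_eq_0_iff: "u \<beta> = 0 \<longleftrightarrow> \<beta> = 0"
  using u by (metis embedding_0 inj_eq lattice_embedding_def)

lemma embedding_delta: "u (int n, int n) = (int n, int n)"
proof (induction n)
  case (Suc n)
  have "(int (Suc n), int (Suc n)) = delta + (int n, int n)"
    by (simp add: delta_def)
  moreover have "u delta = delta"
    using u by (simp add: lattice_embedding_def)
  ultimately show ?case
    using Suc by (simp only: embedding_add)
qed (simp flip: zero_prod_def)

end

lemma lattice_embedding_id: "lattice_embedding id"
  by (simp add: lattice_embedding_def)

lemma lattice_embedding_refl:
  assumes "lattice_embedding u"
  shows "lattice_embedding (u \<circ> refl i)"
proof -
  have "inj (refl i)"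
    by (metis inj_on_id inj_on_imageI2 refl_involution)
  moreover have "refl i delta = delta"
    by (cases i) (simp_all add: delta_def)
  ultimately show ?thesis
    using assms unfolding lattice_embedding_def
    by (simp only: refl_add inj_compose comp_apply simp_thms)
qed

text \<open>The cosets of \<open>W\<close> correspond to the integers: \<open>k\<close> stands for the coset of the translation
  \<open>translation k\<close>, and the reflections act by \<open>k \<mapsto> 1 - k\<close> and \<open>k \<mapsto> - k\<close>.\<close>

definition translation :: "int \<Rightarrow> weyl" where
  "translation k \<beta> = \<beta> - smul (2 * k * (snd \<beta> - fst \<beta>)) delta"

fun node_sum :: "node \<Rightarrow> int" where
  "node_sum I0 = 1"
| "node_sum I1 = 0"

text \<open>\<open>translation k\<close> is the k-th power of s_0 s_1, so s_1 inverts it and s_0 is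
  \<open>translation 1\<close> followed on the right by s_1. The s_1 left over on the right is
  absorbed by the coset.\<close>

lemma refl_translation: "refl i \<circ> translation k = translation (node_sum i - k) \<circ> refl I1"
  by (cases i) (auto simp: translation_def smul_delta algebra_simps)

lemma left_coset_refl: "left_coset (refl i \<circ> v) = (\<lambda>x. refl i \<circ> x) ` left_coset v"
  by (simp add: left_coset_def image_image comp_assoc)

lemma left_coset_comp_refl: "left_coset (v \<circ> refl I1) = left_coset v"
  using refl_involution[of I1]
  by (auto simp: left_coset_def finite_weyl_def comp_assoc)

lemma left_coset_translation:
  "(\<lambda>x. refl i \<circ> x) ` left_coset (translation k) = left_coset (translation (node_sum i - k))"
  by (metis left_coset_refl refl_translation left_coset_comp_refl)

definition alt_node :: "nat \<Rightarrow> node" where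
  "alt_node n = (if even n then I0 else I1)"

lemma alt_word_Suc: "alt_word (Suc n) = alt_node n # alt_word n"
  by (simp add: alt_node_def)

fun coset_index :: "nat \<Rightarrow> int" where
  "coset_index 0 = 0"
| "coset_index (Suc m) = node_sum (alt_node m) - coset_index m"

lemma word_prod_Nil [simp]: "word_prod [] = id"
  by (simp add: word_prod_def)

lemma word_prod_Cons [simp]: "word_prod (i # w) = refl i \<circ> word_prod w"
  by (simp add: word_prod_def)

lemma left_coset_alt_word:
  "left_coset (word_prod (alt_word m)) = left_coset (translation (coset_index m))"
proof (induction m)
  case 0
  then show ?case
    by (simp add: translation_def id_def smul_delta flip: zero_prod_def)
next
  case (Suc m)
  then show ?case
    by (simp only: alt_word_Suc word_prod_Cons left_coset_refl left_coset_translation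
        coset_index.simps)
qed

section \<open>Sums over subwords and their recursion in the first letter\<close>

definition geom :: "root_lattice \<Rightarrow> ratfun" where
  "geom \<beta> = inverse (1 - fexp \<beta>)"

definition twisted_b :: "weyl \<Rightarrow> node list \<Rightarrow> weyl \<Rightarrow> ratfun" where
  "twisted_b u w v = (\<Sum>\<epsilon> | length \<epsilon> = length w \<and> subword_prod w \<epsilon> = v.
     \<Prod>j<length w. geom (u (subword_prod (take (Suc j) w) (take (Suc j) \<epsilon>) (simple_root (w ! j)))))"

lemma b_bar_eq_twisted_b: "b_bar w v = twisted_b id w v"
  by (simp add: b_bar_def twisted_b_def geom_def)

lemma subword_prod_Nil [simp]: "subword_prod [] \<epsilon> = id"
  by (simp add: subword_prod_def)

lemma subword_prod_Cons [simp]: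
  "subword_prod (i # w) (e # \<epsilon>) = (if e then refl i else id) \<circ> subword_prod w \<epsilon>"
  by (simp add: subword_prod_def)

lemma twisted_b_Nil: "twisted_b u [] v = (if v = id then 1 else 0)"
proof -
  have "{\<epsilon>::bool list. \<epsilon> = [] \<and> id = v} = (if v = id then {[]} else {})"
    by auto
  then show ?thesis
    by (simp add: twisted_b_def)
qed

lemma refl_refl_comp: "refl i \<circ> (refl i \<circ> x) = x"
  by (metis comp_assoc id_comp refl_involution)

lemma refl_comp_eq_iff: "refl i \<circ> x = v \<longleftrightarrow> x = refl i \<circ> v"
  by (metis refl_refl_comp)

text \<open>Split by the first exponent. If it is 1, the first root becomes
  \<open>- simple_root i\<close>, every later prefix product gains \<open>refl i\<close> on the
  left, which joins \<open>u\<close>, and the remaining letters must multiply to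
  \<open>refl i \<circ> v\<close>.\<close>

lemma twisted_b_Cons:
  "twisted_b u (i # w) v =
     geom (u (simple_root i)) * twisted_b u w v +
     geom (u (- simple_root i)) * twisted_b (u \<circ> refl i) w (refl i \<circ> v)"
proof -
  define X where "X v = {\<epsilon>. length \<epsilon> = length w \<and> subword_prod w \<epsilon> = v}" for v
  define f where "f \<epsilon> = (\<Prod>j<length (i # w). geom (u (subword_prod (take (Suc j) (i # w))
    (take (Suc j) \<epsilon>) (simple_root ((i # w) ! j)))))" for \<epsilon>
  define g where "g u \<epsilon> = (\<Prod>j<length w. geom (u (subword_prod (take (Suc j) w)
    (take (Suc j) \<epsilon>) (simple_root (w ! j)))))" for u \<epsilon>
  have fin: "finite (X v)" for v
    by (rule finite_subset[OF _ finite_lists_length_eq[of "UNIV :: bool set" "length w"]])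
       (auto simp: X_def)
  have split: "{\<epsilon>. length \<epsilon> = length (i # w) \<and> subword_prod (i # w) \<epsilon> = v} =
      Cons False ` X v \<union> Cons True ` X (refl i \<circ> v)"
    by (auto simp: X_def length_Suc_conv refl_comp_eq_iff refl_refl_comp image_iff)
  have F: "f (False # \<epsilon>) = geom (u (simple_root i)) * g u \<epsilon>" for \<epsilon>
    by (simp add: f_def g_def prod.lessThan_Suc_shift del: prod.lessThan_Suc)
  have T: "f (True # \<epsilon>) = geom (u (- simple_root i)) * g (u \<circ> refl i) \<epsilon>" for \<epsilon>
    by (simp add: f_def g_def prod.lessThan_Suc_shift refl_simple_root del: prod.lessThan_Suc)
  have "twisted_b u (i # w) v = sum f (Cons False ` X v \<union> Cons True ` X (refl i \<circ> v))"
    unfolding twisted_b_def f_def split ..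
  also have "\<dots> = sum f (Cons False ` X v) + sum f (Cons True ` X (refl i \<circ> v))"
    by (rule sum.union_disjoint) (auto simp: fin)
  also have "\<dots> = (\<Sum>\<epsilon>\<in>X v. f (False # \<epsilon>)) + (\<Sum>\<epsilon>\<in>X (refl i \<circ> v). f (True # \<epsilon>))"
    by (simp add: sum.reindex)
  also have "\<dots> = geom (u (simple_root i)) * twisted_b u w v +
     geom (u (- simple_root i)) * twisted_b (u \<circ> refl i) w (refl i \<circ> v)"
    unfolding F T by (simp add: sum_distrib_left twisted_b_def X_def g_def)
  finally show ?thesis .
qed

definition twisted_R :: "weyl \<Rightarrow> nat \<Rightarrow> int \<Rightarrow> ratfun" where
  "twisted_R u n k = (\<Sum>v\<in>left_coset (translation k). twisted_b u (alt_word n) v)"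

lemma R_eq_twisted_R: "R m n = twisted_R id n (coset_index m)"
  by (simp add: R_def twisted_R_def left_coset_alt_word b_bar_eq_twisted_b)

lemma twisted_R_0: "twisted_R u 0 k = (if k = 0 then 1 else 0)"
proof -
  have "translation k = id \<longleftrightarrow> k = 0"
  proof
    assume "translation k = id"
    \<comment> \<open>The value at \<alpha>_1 suffices to tell apart the operators compared here and
      below.\<close>
    from fun_cong[OF this, of "(0, 1)"] show "k = 0"
      by (simp add: translation_def smul_delta)
  qed (auto simp: translation_def smul_delta fun_eq_iff simp flip: zero_prod_def)
  moreover have "translation k \<circ> refl I1 \<noteq> id"
  proof
    assume "translation k \<circ> refl I1 = id"
    from fun_cong[OF this, of "(0, 1)"] show False
      by (auto simp: translation_def smul_delta)
  qed
  moreover have "translation k \<noteq> translation k \<circ> refl I1"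
  proof
    assume "translation k = translation k \<circ> refl I1"
    from fun_cong[OF this, of "(0, 1)"] show False
      by (auto simp: translation_def smul_delta)
  qed
  ultimately show ?thesis
    by (auto simp: twisted_R_def left_coset_def finite_weyl_def twisted_b_Nil eq_commute[of id])
qed

text \<open>Summing \<open>twisted_b_Cons\<close> over a coset works because left multiplication by
  \<open>refl i\<close> maps coset \<open>k\<close> bijectively onto coset
  \<open>node_sum i - k\<close>.\<close>

lemma twisted_R_Suc:
  assumes "i = alt_node n"
  shows "twisted_R u (Suc n) k =
     geom (u (simple_root i)) * twisted_R u n k +
     geom (u (- simple_root i)) * twisted_R (u \<circ> refl i) n (node_sum i - k)"
proof -
  have "inj_on (\<lambda>x. refl i \<circ> x) A" for A
    by (rule inj_onI) (metis refl_comp_eq_iff)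
  then have "twisted_R (u \<circ> refl i) n (node_sum i - k) =
      (\<Sum>v\<in>left_coset (translation k). twisted_b (u \<circ> refl i) (alt_word n) (refl i \<circ> v))"
    unfolding twisted_R_def left_coset_translation[symmetric]
    by (subst sum.reindex) simp_all
  then show ?thesis
    unfolding twisted_R_def alt_word_Suc assms[symmetric] twisted_b_Cons
    by (simp only: sum.distrib sum_distrib_left)
qed


subsection \<open>The closed form\<close>

text \<open>This is \<open>c \<delta> - \<alpha>\<^sub>1\<close>; these roots and their negatives
  are all the real roots.\<close>

definition root_line :: "int \<Rightarrow> root_lattice" where
  "root_line c = (c, c - 1)"

text \<open>The weight of the torus-invariant curve joining the fixed points \<open>k\<close> and \<open>j\<close>,
  at the point \<open>k\<close>.\<close>

definition curve_weight :: "int \<Rightarrow> int \<Rightarrow> root_lattice" where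
  "curve_weight k j = (if k < j then root_line (k + j) else - root_line (k + j))"

text \<open>\<open>refl i\<close> sends \<open>root_line c\<close> to
  \<open>- root_line (2 * node_sum i - c)\<close>. The sign is compensated by the reversed order of
  the two indices.\<close>

lemma refl_curve_weight:
  assumes "j \<noteq> node_sum i - k"
  shows "refl i (curve_weight (node_sum i - k) j) = curve_weight k (node_sum i - j)"
  using assms by (cases i) (auto simp: curve_weight_def root_line_def)

text \<open>The binomial carries no \<open>u\<close> because lattice embeddings fix \<delta>. The
  value 0 outside the interval lets the recursion hold at the end points too.\<close>

definition interval_R :: "weyl \<Rightarrow> int \<Rightarrow> int \<Rightarrow> int \<Rightarrow> ratfun" where
  "interval_R u lo hi k = (if k \<in> {lo..hi} then
     qbinom (fexp delta) (nat (k - lo)) (nat (hi - k)) *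
     (\<Prod>j\<in>{lo..hi} - {k}. geom (u (curve_weight k j))) else 0)"

lemma interval_R_refl:
  "interval_R (u \<circ> refl i) lo hi (node_sum i - k) =
   interval_R u (node_sum i - hi) (node_sum i - lo) k"
proof -
  let ?c = "node_sum i"
  have "bij_betw (\<lambda>j. ?c - j) ({lo..hi} - {?c - k}) ({?c - hi..?c - lo} - {k})"
    by (rule bij_betwI[where g = "\<lambda>j. ?c - j"]) auto
  then have "(\<Prod>j\<in>{lo..hi} - {?c - k}. geom (u (curve_weight k (?c - j)))) =
      (\<Prod>j\<in>{?c - hi..?c - lo} - {k}. geom (u (curve_weight k j)))"
    by (rule prod.reindex_bij_betw)
  moreover have "nat (hi - (?c - k)) = nat (k - (?c - hi))" "nat (?c - k - lo) = nat (?c - lo - k)"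
    by (simp_all add: algebra_simps)
  moreover have "?c - k \<in> {lo..hi} \<longleftrightarrow> k \<in> {?c - hi..?c - lo}"
    by auto
  moreover have "(\<Prod>j\<in>{lo..hi} - {?c - k}. geom ((u \<circ> refl i) (curve_weight (?c - k) j))) =
      (\<Prod>j\<in>{lo..hi} - {?c - k}. geom (u (curve_weight k (?c - j))))"
    by (intro prod.cong) (simp_all add: refl_curve_weight)
  ultimately show ?thesis
    unfolding interval_R_def by (simp add: qbinom_commute del: atLeastAtMost_iff)
qed

lemma fexp_delta_power_neq_1: "n > 0 \<Longrightarrow> fexp delta ^ n \<noteq> 1"
  by (simp add: zero_prod_def flip: fexp_smul_delta)

lemma root_line_nonzero: "root_line c \<noteq> 0"
  by (simp add: root_line_def zero_prod_def)

text \<open>Dropping the end \<open>H\<close> or \<open>L\<close> removes one factor from the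
  product over the interval. Both removed factors are expressed through
  \<open>v = fexp \<beta>\<close> and powers of q, which reduces the claim to
  \<open>qbinom_pascal\<close>.\<close>

lemma interval_R_rec:
  assumes u: "lattice_embedding u" and "L < H"
  defines "\<beta> \<equiv> u (root_line (L + H))"
  shows "interval_R u L H k =
    geom \<beta> * interval_R u L (H - 1) k + geom (- \<beta>) * interval_R u (L + 1) H k"
proof -
  define q v where "q = fexp delta" and "v = fexp \<beta>"
  define f where "f j = 1 - fexp (u (curve_weight k j))" for j
  define Q where "Q J = (\<Prod>j\<in>J - {k}. geom (u (curve_weight k j)))" for J
  have Q: "Q J = inverse (f j) * Q (J - {j})" if "finite J" "j \<in> J" "j \<noteq> k" for J j
  proof -
    have "J - {k} = insert j (J - {j} - {k})" using that by auto
    then show ?thesis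
      using that by (simp add: Q_def geom_def f_def)
  qed
  have "\<beta> \<noteq> 0"
    by (simp add: \<beta>_def embedding_eq_0_iff[OF u] root_line_nonzero)
  then have v: "v \<noteq> 1" "v \<noteq> 0"
    by (simp_all add: v_def)
  have f_nz: "f j \<noteq> 0" for j
    by (simp add: f_def curve_weight_def embedding_eq_0_iff[OF u] root_line_nonzero)
  have geom: "geom \<beta> = inverse (1 - v)" "geom (- \<beta>) = - v * inverse (1 - v)"
    using v by (simp_all add: geom_def v_def fexp_minus field_simps)
  have fH: "f H = 1 - v * q ^ nat (k - L)" if "L \<le> k" "k < H"
  proof -
    have "curve_weight k H = root_line (L + H) + (int (nat (k - L)), int (nat (k - L)))"
      using that by (simp add: curve_weight_def root_line_def)
    then show ?thesis
      by (simp add: f_def embedding_add[OF u] embedding_delta[OF u] fexp_add fexp_smul_delta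
          v_def q_def \<beta>_def del: int_nat_eq)
  qed
  have fL: "f L = 1 - inverse v * q ^ nat (H - k)" if "L < k" "k \<le> H"
  proof -
    have "curve_weight k L = - root_line (L + H) + (int (nat (H - k)), int (nat (H - k)))"
      using that by (simp add: curve_weight_def root_line_def)
    then show ?thesis
      by (simp only: f_def embedding_add[OF u] embedding_minus[OF u] embedding_delta[OF u] fexp_add
          fexp_smul_delta fexp_minus v_def q_def \<beta>_def)
  qed
  have q: "n > 0 \<Longrightarrow> q ^ n \<noteq> 1" for n
    by (simp add: q_def fexp_delta_power_neq_1)
  have qb0: "qbinom q 0 n = 1" "qbinom q n 0 = 1" for n
    using qfact_nonzero[OF q] by (simp_all add: qbinom_def)
  have R: "interval_R u lo hi k =
      (if k \<in> {lo..hi} then qbinom q (nat (k - lo)) (nat (hi - k)) * Q {lo..hi} else 0)" for lo hi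
    by (simp add: interval_R_def q_def Q_def)
  have J: "{L..H} - {H} = {L..H - 1}" "{L..H} - {L} = {L + 1..H}"
    by auto
  \<comment> \<open>At an end point only one of the two shorter intervals contains \<open>k\<close>,
    and all binomials are 1.\<close>
  consider "k < L \<or> H < k" | "k = L" | "k = H" | "L < k" "k < H"
    by linarith
  then show ?thesis
  proof cases
    case 1
    then show ?thesis by (auto simp: R)
  next
    case 2
    with \<open>L < H\<close> show ?thesis
      unfolding R geom using Q[of "{L..H}" H] fH by (simp add: qb0 J)
  next
    case 3
    with \<open>L < H\<close> show ?thesis
      unfolding R geom using Q[of "{L..H}" L] fL v by (simp add: qb0 J field_simps)
  next
    case 4
    \<comment> \<open>Counting only the points strictly between \<open>k\<close> and the ends gives
      the \<open>Suc\<close> form of the Pascal rule.\<close>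
    define a b where "a = nat (k - L - 1)" and "b = nat (H - k - 1)"
    have ab: "nat (k - L) = Suc a" "nat (H - k) = Suc b" "nat (H - 1 - k) = b" "nat (k - (L + 1)) = a"
      using 4 by (simp_all add: a_def b_def)
    have "Q {L..H} = inverse (f H) * Q {L..H - 1}" "Q {L..H} = inverse (f L) * Q {L + 1..H}"
      using Q[of "{L..H}" H] Q[of "{L..H}" L] 4 unfolding J by simp_all
    then have 1: "Q {L..H - 1} = f H * Q {L..H}" "Q {L + 1..H} = f L * Q {L..H}"
      using f_nz by (metis mult.assoc mult_1 right_inverse)+
    have "v * f L = v - q ^ Suc b"
      using fL 4 v by (simp add: ab field_simps)
    then have "(1 - v) * qbinom q (Suc a) (Suc b) = f H * qbinom q (Suc a) b - v * f L * qbinom q a (Suc b)"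
      using qbinom_pascal[OF q, of v a b] fH 4 by (simp only: ab)
    then have "qbinom q (Suc a) (Suc b) =
        inverse (1 - v) * (f H * qbinom q (Suc a) b - v * f L * qbinom q a (Suc b))"
      using v by (metis eq_iff_diff_eq_0 left_inverse mult.assoc mult_1)
    then show ?thesis
      unfolding R ab 1 geom using 4 by simp (simp add: algebra_simps)
  qed
qed

text \<open>The values of \<open>coset_index\<close> are 0, 1, -1, 2, -2, ...; the first
  \<open>n + 1\<close> of them fill the interval from \<open>lo_end n\<close> to
  \<open>hi_end n\<close>.\<close>

definition lo_end :: "nat \<Rightarrow> int" where "lo_end n = - int (n div 2)"
definition hi_end :: "nat \<Rightarrow> int" where "hi_end n = int ((n + 1) div 2)"

text \<open>The new letter reflects the old interval to one shifted by a single step, and the new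
  interval is their union. Its ends add up to 1 for s_0 and 0 for s_1, so the root in
  \<open>interval_R_rec\<close> is \<alpha>_0 or -\<alpha>_1. All \<open>u\<close> are treated at
  once since the recursion passes to \<open>u \<circ> refl i\<close>.\<close>

lemma twisted_R_eq_interval_R:
  "lattice_embedding u \<Longrightarrow> twisted_R u n k = interval_R u (lo_end n) (hi_end n) k"
proof (induction n arbitrary: u k)
  case 0
  then show ?case
    by (simp add: twisted_R_0 interval_R_def lo_end_def hi_end_def qbinom_def)
next
  case (Suc n)
  note u = Suc.prems
  note IH = Suc.IH[OF u] Suc.IH[OF lattice_embedding_refl[OF u]]
  show ?case
  proof (cases "even n")
    case True
    then obtain p where n: "n = 2 * p" by blast
    have *: "lo_end n = - int p" "hi_end n = int p" "lo_end (Suc n) = - int p"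
      "hi_end (Suc n) = int p + 1"
      by (simp_all add: n lo_end_def hi_end_def)
    have "I0 = alt_node n"
      by (simp add: alt_node_def n)
    moreover have "simple_root I0 = root_line 1"
      by (simp add: root_line_def)
    ultimately show ?thesis
      using interval_R_rec[OF u, of "- int p" "int p + 1" k]
      unfolding twisted_R_Suc[OF \<open>I0 = alt_node n\<close>] IH interval_R_refl *
      by (simp add: embedding_minus[OF u] algebra_simps del: simple_root.simps)
  next
    case False
    then obtain p where n: "n = Suc (2 * p)" by (metis oddE Suc_eq_plus1)
    have *: "lo_end n = - int p" "hi_end n = int p + 1" "lo_end (Suc n) = - 1 - int p"
      "hi_end (Suc n) = int p + 1"
      by (simp_all add: n lo_end_def hi_end_def)
    have "I1 = alt_node n"
      by (simp add: alt_node_def n)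
    moreover have "simple_root I1 = - root_line 0"
      by (simp add: root_line_def)
    ultimately show ?thesis
      using interval_R_rec[OF u, of "- 1 - int p" "int p + 1" k]
      unfolding twisted_R_Suc[OF \<open>I1 = alt_node n\<close>] IH interval_R_refl *
      by (simp add: embedding_minus[OF u] algebra_simps del: simple_root.simps)
  qed
qed


subsection \<open>Rewriting in terms of positive roots\<close>

definition pos_real_root :: "int \<Rightarrow> root_lattice" where
  "pos_real_root c = (if c \<ge> 1 then root_line c else - root_line c)"

lemma pos_roots_eq:
  "pos_roots = range pos_real_root \<union> (\<lambda>n. (int n, int n)) ` {1..}"
proof (intro equalityI subsetI)
  fix \<alpha> assume "\<alpha> \<in> pos_roots"
  then consider "\<alpha> = simple_root I1" | n where "n \<ge> 1" "\<alpha> = simple_root I1 + smul n delta"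
    | n where "n \<ge> 1" "\<alpha> = - simple_root I1 + smul n delta" | n where "n \<ge> 1" "\<alpha> = smul n delta"
    by (auto simp: pos_roots_def)
  then show "\<alpha> \<in> range pos_real_root \<union> (\<lambda>n. (int n, int n)) ` {1..}"
  proof cases
    case 1
    then have "\<alpha> = pos_real_root 0"
      by (simp add: pos_real_root_def root_line_def)
    then show ?thesis by blast
  next
    case (2 n)
    then have "\<alpha> = pos_real_root (- n)"
      by (simp add: pos_real_root_def root_line_def smul_delta)
    then show ?thesis by blast
  next
    case (3 n)
    then have "\<alpha> = pos_real_root n"
      by (simp add: pos_real_root_def root_line_def smul_delta)
    then show ?thesis by blast
  next
    case (4 n)
    then have "\<alpha> = (int (nat n), int (nat n))" "nat n \<in> {1..}"
      by (auto simp: smul_delta)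
    then show ?thesis by blast
  qed
next
  fix \<alpha> assume "\<alpha> \<in> range pos_real_root \<union> (\<lambda>n. (int n, int n)) ` {1..}"
  then consider c where "\<alpha> = pos_real_root c" | n where "n \<ge> 1" "\<alpha> = (int n, int n)"
    by auto
  then show "\<alpha> \<in> pos_roots"
  proof cases
    case (1 c)
    consider "c \<ge> 1" | "c = 0" | "c \<le> - 1" by linarith
    then show ?thesis
    proof cases
      case _: 1
      then have "\<alpha> = - simple_root I1 + smul c delta"
        using 1 by (simp add: pos_real_root_def root_line_def smul_delta)
      then show ?thesis
        using \<open>c \<ge> 1\<close> unfolding pos_roots_def by blast
    next
      case 2
      then show ?thesis
        using 1 by (simp add: pos_real_root_def root_line_def pos_roots_def)
    next
      case 3
      then have "\<alpha> = simple_root I1 + smul (- c) delta" "- c \<ge> 1"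
        using 1 by (simp_all add: pos_real_root_def root_line_def smul_delta)
      then show ?thesis
        unfolding pos_roots_def by blast
    qed
  next
    case (2 n)
    then have "\<alpha> = smul (int n) delta" "int n \<ge> 1"
      by (simp_all add: smul_delta)
    then show ?thesis
      unfolding pos_roots_def by blast
  qed
qed

lemma inj_pos_real_root: "inj pos_real_root"
  by (rule injI) (auto simp: pos_real_root_def root_line_def split: if_splits)

text \<open>The positive roots sent to negative roots by \<open>w\<^sub>m\<^sup>-\<^sup>1\<close> are
  \<open>inversion_root m i\<close> with \<open>i < m\<close>, and \<open>w\<^sub>m \<alpha>\<^sub>1\<close> is the next root in this sequence.\<close>

definition inversion_root :: "nat \<Rightarrow> nat \<Rightarrow> root_lattice" where
  "inversion_root m i = (if even m then (int i, int i + 1) else (int i + 1, int i))"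

lemma refl_inversion_root:
  "refl (alt_node m) (inversion_root m i) = inversion_root (Suc m) (Suc i)"
  by (simp add: alt_node_def inversion_root_def)

lemma word_prod_alt_word: "word_prod (alt_word m) (simple_root I1) = inversion_root m m"
proof (induction m)
  case (Suc m)
  then show ?case
    by (simp add: alt_word_Suc refl_inversion_root del: alt_word.simps simple_root.simps)
qed (simp add: inversion_root_def)

lemma refl_sum: "refl i (\<Sum>x\<in>A. f x) = (\<Sum>x\<in>A. refl i (f x))"
proof (induction A rule: infinite_finite_induct)
  case (insert x A)
  then show ?case by (simp add: refl_add)
qed (cases i; simp add: zero_prod_def)+

lemma S_eq_fexp: "S w = fexp (\<Sum>j<length w. word_prod (take j w) (simple_root (w ! j)))"
  by (simp add: S_def fexp_sum)

text \<open>A prepended letter contributes its simple root, the inversion root of index 0, and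
  shifts the earlier ones by \<open>refl_inversion_root\<close>.\<close>

lemma S_alt_word: "S (alt_word m) = fexp (\<Sum>i<m. inversion_root m i)"
proof -
  have "(\<Sum>j<length (alt_word m). word_prod (take j (alt_word m)) (simple_root (alt_word m ! j))) =
      (\<Sum>i<m. inversion_root m i)"
  proof (induction m)
    case (Suc m)
    have "simple_root (alt_node m) = inversion_root (Suc m) 0"
      by (simp add: alt_node_def inversion_root_def)
    then show ?case
      by (simp add: alt_word_Suc sum.lessThan_Suc_shift Suc refl_inversion_root flip: refl_sum
          del: alt_word.simps sum.lessThan_Suc)
         (simp add: refl_sum refl_inversion_root)
  qed simp
  then show ?thesis
    by (simp add: S_eq_fexp)
qed

lemma coset_index_eq: "2 * coset_index m = (if even m then - int m else int m + 1)"
  by (induction m) (auto simp: alt_node_def)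

text \<open>Chosen to clear denominators: the real roots match the curve weights up to sign, with
  \<open>j = k\<close> added, and the imaginary roots match one of the two q-factorials under the
  binomial.\<close>

definition finite_roots :: "nat \<Rightarrow> nat \<Rightarrow> root_lattice set" where
  "finite_roots m n =
     (\<lambda>j. pos_real_root (coset_index m + j)) ` {lo_end n..hi_end n} \<union>
     (\<lambda>i. (int i, int i)) ` {1..nat (coset_index m - lo_end n)}"

lemma finite_finite_roots: "finite (finite_roots m n)"
  by (simp add: finite_roots_def)

lemma finite_roots_subset: "finite_roots m n \<subseteq> pos_roots"
  by (auto simp: finite_roots_def pos_roots_eq)

lemma prod_finite_roots:
  "(\<Prod>\<alpha>\<in>finite_roots m n. 1 - fexp \<alpha>) =
   (\<Prod>j\<in>{lo_end n..hi_end n}. 1 - fexp (pos_real_root (coset_index m + j))) *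
   qfact (fexp delta) (nat (coset_index m - lo_end n))"
proof -
  have "inj_on (\<lambda>j. pos_real_root (coset_index m + j)) A" for A
    by (rule inj_onI) (metis add_left_cancel injD inj_pos_real_root)
  moreover have "inj_on (\<lambda>i. (int i, int i)) A" for A
    by (auto simp: inj_on_def)
  moreover have "(\<lambda>j. pos_real_root (coset_index m + j)) ` A \<inter> (\<lambda>i. (int i, int i)) ` B = {}" for A B
    by (auto simp: pos_real_root_def root_line_def split: if_splits)
  ultimately show ?thesis
    unfolding finite_roots_def
    by (subst prod.union_disjoint) (simp_all add: prod.reindex qfact_def fexp_smul_delta)
qed

lemma R_eq_0:
  assumes "coset_index m \<notin> {lo_end n..hi_end n}"
  shows "R m n = 0"
  using assms
  by (simp add: R_eq_twisted_R twisted_R_eq_interval_R[OF lattice_embedding_id] interval_R_def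
      del: atLeastAtMost_iff)

lemma R_mult_prod_finite_roots:
  assumes k: "coset_index m \<in> {lo_end n..hi_end n}"
  shows "R m n * (\<Prod>\<alpha>\<in>finite_roots m n. 1 - fexp \<alpha>) =
    (-1) ^ m * S (alt_word m) * (1 - fexp (word_prod (alt_word m) (simple_root I1))) *
    (\<Prod>i\<in>{nat (hi_end n - coset_index m)<..n}. 1 - fexp (int i, int i))"
proof -
  define k where "k = coset_index m"
  define I where "I = {lo_end n..hi_end n}"
  define J where "J = I - {k}"
  define q where "q = fexp delta"
  define a b where "a = nat (k - lo_end n)" and "b = nat (hi_end n - k)"
  \<comment> \<open>The indices whose curve weight is a negative root; \<open>g\<close> below
    enumerates them in the order of the inversion roots.\<close>
  define neg where "neg = {j \<in> J. (k < j) \<noteq> (k + j \<ge> 1)}"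
  define g where "g i = (if even m then - int i else int i + 1) - k" for i
  have kI: "k \<in> I" and fin: "finite I" "finite J"
    using k by (simp_all add: k_def I_def J_def)
  have n: "n = a + b"
    using k by (auto simp: a_def b_def k_def lo_end_def hi_end_def)
  have k2: "2 * k = (if even m then - int m else int m + 1)"
    unfolding k_def by (rule coset_index_eq)
  \<comment> \<open>With \<open>k\<close> the interval also contains \<open>- k\<close> and
    \<open>1 - k\<close>, hence all of \<open>neg\<close>.\<close>
  have ends: "- lo_end n \<le> hi_end n" "hi_end n \<le> 1 - lo_end n"
    by (auto simp: lo_end_def hi_end_def)
  have w: "pos_real_root (k + k) = word_prod (alt_word m) (simple_root I1)"
    using k2 unfolding word_prod_alt_word
    by (auto simp: pos_real_root_def root_line_def inversion_root_def)

  have "neg = g ` {..<m}"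
  proof (intro equalityI subsetI)
    fix j assume j: "j \<in> neg"
    show "j \<in> g ` {..<m}"
    proof (cases "even m")
      case True
      then have "nat (- k - j) < m" "j = g (nat (- k - j))"
        using j k2 by (auto simp: neg_def J_def g_def)
      then show ?thesis by blast
    next
      case False
      then have "nat (k + j - 1) < m" "j = g (nat (k + j - 1))"
        using j k2 by (auto simp: neg_def J_def g_def)
      then show ?thesis by blast
    qed
  next
    fix j assume "j \<in> g ` {..<m}"
    then show "j \<in> neg"
      using ends k k2 by (auto simp: neg_def J_def I_def g_def k_def[symmetric] split: if_splits)
  qed
  moreover have "inj g"
    by (auto simp: inj_def g_def)
  moreover have "pos_real_root (k + g i) = inversion_root m i" for i
    by (auto simp: g_def pos_real_root_def root_line_def inversion_root_def)
  ultimately have neg: "(\<Prod>j\<in>neg. - fexp (pos_real_root (k + j))) = (-1) ^ m * S (alt_word m)"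
    by (simp add: prod.reindex inj_on_subset S_alt_word fexp_sum prod_uminus card_image)

  \<comment> \<open>For a negative weight this is (1 - x) / (1 - 1/x) = -x; otherwise the factors
    cancel.\<close>
  have "geom (curve_weight k j) * (1 - fexp (pos_real_root (k + j))) =
      (if j \<in> neg then - fexp (pos_real_root (k + j)) else 1)" if "j \<in> J" for j
  proof (cases "j \<in> neg")
    case True
    then have "curve_weight k j = - pos_real_root (k + j)"
      by (auto simp: neg_def curve_weight_def pos_real_root_def)
    moreover have "fexp (pos_real_root (k + j)) \<noteq> 1"
      by (simp add: pos_real_root_def root_line_nonzero)
    ultimately show ?thesis
      using True by (simp add: geom_def fexp_minus field_simps)
  next
    case False
    then have "curve_weight k j = pos_real_root (k + j)"
      using that by (auto simp: neg_def curve_weight_def pos_real_root_def)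
    then show ?thesis
      using False by (simp add: geom_def pos_real_root_def root_line_nonzero)
  qed
  then have "(\<Prod>j\<in>J. geom (curve_weight k j)) * (\<Prod>j\<in>J. 1 - fexp (pos_real_root (k + j))) =
      (\<Prod>j\<in>J. if j \<in> neg then - fexp (pos_real_root (k + j)) else 1)"
    by (simp flip: prod.distrib)
  also have "\<dots> = (\<Prod>j\<in>neg. - fexp (pos_real_root (k + j)))"
    by (rule prod.mono_neutral_cong_right) (auto simp: fin neg_def)
  finally have J: "(\<Prod>j\<in>J. geom (curve_weight k j)) * (\<Prod>j\<in>J. 1 - fexp (pos_real_root (k + j))) =
      (-1) ^ m * S (alt_word m)"
    by (simp only: neg)

  have R: "R m n = qbinom q a b * (\<Prod>j\<in>J. geom (curve_weight k j))"
    using k by (simp add: R_eq_twisted_R twisted_R_eq_interval_R[OF lattice_embedding_id]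
        interval_R_def J_def I_def q_def a_def b_def k_def)
  have "(\<Prod>j\<in>I. 1 - fexp (pos_real_root (k + j))) =
      (1 - fexp (word_prod (alt_word m) (simple_root I1))) *
      (\<Prod>j\<in>J. 1 - fexp (pos_real_root (k + j)))"
    unfolding J_def w[symmetric] using fin(1) kI by (rule prod.remove)
  then have P: "(\<Prod>\<alpha>\<in>finite_roots m n. 1 - fexp \<alpha>) =
      (1 - fexp (word_prod (alt_word m) (simple_root I1))) *
      (\<Prod>j\<in>J. 1 - fexp (pos_real_root (k + j))) * qfact q a"
    by (simp add: prod_finite_roots k_def I_def q_def a_def)
  have "{1..n} = {1..b} \<union> {b<..n}" "{1..b} \<inter> {b<..n} = {}"
    using n by auto
  then have "qfact q n = qfact q b * (\<Prod>i\<in>{b<..n}. 1 - q ^ i)"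
    by (simp add: qfact_def prod.union_disjoint)
  moreover have "qfact q r \<noteq> 0" for r
    by (rule qfact_nonzero) (simp add: q_def fexp_delta_power_neq_1)
  ultimately have G: "qbinom q a b * qfact q a = (\<Prod>i\<in>{b<..n}. 1 - q ^ i)"
    by (simp add: qbinom_def n[symmetric])
  have "R m n * (\<Prod>\<alpha>\<in>finite_roots m n. 1 - fexp \<alpha>) =
      ((\<Prod>j\<in>J. geom (curve_weight k j)) * (\<Prod>j\<in>J. 1 - fexp (pos_real_root (k + j)))) *
      (1 - fexp (word_prod (alt_word m) (simple_root I1))) * (qbinom q a b * qfact q a)"
    unfolding R P by (simp only: ac_simps)
  then show ?thesis
    unfolding J G by (simp add: fexp_smul_delta q_def b_def k_def)
qed


subsection \<open>Power series expansions and the limit\<close>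

text \<open>All positive roots except \<open>\<alpha>\<^sub>1\<close> involve \<open>\<alpha>\<^sub>0\<close>, and only finitely many have a given
  \<open>\<alpha>\<^sub>0\<close>-coefficient, so everything already converges adically in the outer variable.\<close>

lemma fps_mult_nth_cong:
  assumes "\<And>j. j \<le> i \<Longrightarrow> fps_nth F j = fps_nth F' j" "\<And>j. j \<le> i \<Longrightarrow> fps_nth G j = fps_nth G' j"
  shows "fps_nth (F * G) i = fps_nth (F' * G') i"
  unfolding fps_mult_nth by (intro sum.cong) (simp_all add: assms)

lemma fps_prod_nth_eq_1:
  fixes f :: "'a \<Rightarrow> 'b::comm_ring_1 fps"
  assumes "\<And>a j. a \<in> A \<Longrightarrow> j \<le> i \<Longrightarrow> fps_nth (f a) j = fps_nth 1 j" "j \<le> i"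
  shows "fps_nth (prod f A) j = fps_nth 1 j"
  using assms
proof (induction A arbitrary: j rule: infinite_finite_induct)
  case (insert a A)
  have "fps_nth (f a * prod f A) j = fps_nth (1 * 1) j"
    by (rule fps_mult_nth_cong) (use insert in auto)
  then show ?case
    using insert.hyps by simp
qed simp_all

lemma fps_prod_nth_subset:
  fixes f :: "'a \<Rightarrow> 'b::comm_ring_1 fps"
  assumes "finite A" "B \<subseteq> A"
    and "\<And>a j. a \<in> A - B \<Longrightarrow> j \<le> i \<Longrightarrow> fps_nth (f a) j = fps_nth 1 j"
  shows "fps_nth (prod f A) i = fps_nth (prod f B) i"
proof -
  have "fps_nth (prod f B * prod f (A - B)) i = fps_nth (prod f B * 1) i"
    by (rule fps_mult_nth_cong) (use assms fps_prod_nth_eq_1[of "A - B" i f] in auto)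
  then show ?thesis
    using prod.subset_diff[OF assms(2,1), of f] by (simp add: mult.commute)
qed

lemma fps_dvd_1I:
  fixes F :: "'a::comm_ring_1 fps"
  assumes "fps_nth F 0 dvd 1"
  shows "F dvd 1"
  using assms fps_right_inverse[of F] by (metis dvdE dvd_triv_left)

lemma prod_dvd_1:
  fixes f :: "'a \<Rightarrow> 'b::comm_ring_1"
  assumes "\<And>a. a \<in> A \<Longrightarrow> f a dvd 1"
  shows "prod f A dvd 1"
  using assms
proof (induction A rule: infinite_finite_induct)
  case (insert a A)
  then show ?case
    using mult_dvd_mono[of "f a" 1 "prod f A" 1] by simp
qed simp_all

section \<open>Power series expansions of rational functions\<close>

lemma series_of_poly_diff: "series_of_poly (p - q) = series_of_poly p - series_of_poly q"
  by (rule fps_ext) (simp add: series_of_poly_def coeff_map_poly fps_of_poly_diff)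

lemma series_of_poly_1 [simp]: "series_of_poly 1 = 1"
  by (simp add: series_of_poly_def)

lemma expands_toI:
  "q \<noteq> 0 \<Longrightarrow> r = Fract p q \<Longrightarrow> F * series_of_poly q = series_of_poly p \<Longrightarrow> expands_to r F"
  unfolding expands_to_def by blast

lemma expands_to_of_poly: "expands_to (Fract p 1) (series_of_poly p)"
  by (rule expands_toI[of 1]) simp_all

lemma expands_to_1: "expands_to 1 1"
  using expands_to_of_poly[of 1] by (simp add: One_fract_def)

lemma expands_to_0: "expands_to 0 0"
  using expands_to_of_poly[of 0] by (simp add: Zero_fract_def series_of_poly_def)

lemma expands_to_mult:
  assumes "expands_to r F" "expands_to s G"
  shows "expands_to (r * s) (F * G)"
proof -
  obtain p q p' q' where *: "q \<noteq> 0" "r = Fract p q" "F * series_of_poly q = series_of_poly p"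
    "q' \<noteq> 0" "s = Fract p' q'" "G * series_of_poly q' = series_of_poly p'"
    using assms unfolding expands_to_def by blast
  show ?thesis
  proof (rule expands_toI)
    show "q * q' \<noteq> 0" "r * s = Fract (p * p') (q * q')"
      using * by simp_all
    show "F * G * series_of_poly (q * q') = series_of_poly (p * p')"
      by (simp add: series_of_poly_mult flip: *(3) *(6))
  qed
qed

lemma expands_to_diff:
  assumes "expands_to r F" "expands_to s G"
  shows "expands_to (r - s) (F - G)"
proof -
  obtain p q p' q' where *: "q \<noteq> 0" "r = Fract p q" "F * series_of_poly q = series_of_poly p"
    "q' \<noteq> 0" "s = Fract p' q'" "G * series_of_poly q' = series_of_poly p'"
    using assms unfolding expands_to_def by blast
  show ?thesis
  proof (rule expands_toI)
    show "q * q' \<noteq> 0" "r - s = Fract (p * q' - p' * q) (q * q')"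
      using * by simp_all
    show "(F - G) * series_of_poly (q * q') = series_of_poly (p * q' - p' * q)"
      by (simp add: series_of_poly_mult series_of_poly_diff algebra_simps flip: *(3) *(6))
  qed
qed

lemma expands_to_prod:
  assumes "\<And>a. a \<in> A \<Longrightarrow> expands_to (r a) (F a)"
  shows "expands_to (prod r A) (prod F A)"
  using assms
  by (induction A rule: infinite_finite_induct) (simp_all add: expands_to_1 expands_to_mult)

text \<open>The numerator of \<open>r\<close> cannot vanish, since invertibility of \<open>F\<close>
  would then make the denominator vanish as well.\<close>

lemma expands_to_inverse:
  assumes "expands_to r F" "F * G = 1"
  shows "expands_to (inverse r) G"
proof -
  obtain p q where *: "q \<noteq> 0" "r = Fract p q" "F * series_of_poly q = series_of_poly p"
    using assms unfolding expands_to_def by blast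
  have "G * series_of_poly p = series_of_poly q"
    using assms(2) by (metis *(3) mult.assoc mult.commute mult_1)
  moreover from this have "p \<noteq> 0"
    using * by (metis mult_zero_right series_of_poly_eq_0_iff)
  ultimately show ?thesis
    using * by (intro expands_toI[of p _ q]) simp_all
qed

text \<open>Meaningful for nonnegative coordinates only, as \<open>nat\<close> cuts off negative
  ones.\<close>

definition series_exp :: "root_lattice \<Rightarrow> series" where
  "series_exp \<beta> = series_of_poly (monom (monom 1 (nat (snd \<beta>))) (nat (fst \<beta>)))"

lemma expands_to_fexp:
  assumes "fst \<beta> \<ge> 0" "snd \<beta> \<ge> 0"
  shows "expands_to (fexp \<beta>) (series_exp \<beta>)"
  using expands_to_of_poly[of "monom (monom 1 (nat (snd \<beta>))) (nat (fst \<beta>))"] assms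
    fexp_int_int[of "nat (fst \<beta>)" "nat (snd \<beta>)"]
  by (simp add: series_exp_def)

lemma series_exp_nth:
  "fps_nth (series_exp \<beta>) i = (if i = nat (fst \<beta>) then fps_X ^ nat (snd \<beta>) else 0)"
  by (simp add: series_exp_def series_of_poly_def coeff_map_poly fps_of_poly_monom')

section \<open>Root factors and the product over all positive roots\<close>

definition root_factor :: "root_lattice \<Rightarrow> series" where
  "root_factor \<alpha> = 1 - series_exp \<alpha>"

lemma expands_to_root_factor:
  "fst \<alpha> \<ge> 0 \<Longrightarrow> snd \<alpha> \<ge> 0 \<Longrightarrow> expands_to (1 - fexp \<alpha>) (root_factor \<alpha>)"
  unfolding root_factor_def by (intro expands_to_diff expands_to_1 expands_to_fexp)

lemma root_factor_nth: "int i < fst \<alpha> \<Longrightarrow> fps_nth (root_factor \<alpha>) i = fps_nth 1 i"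
  by (auto simp: root_factor_def series_exp_nth)

lemma pos_roots_nonneg:
  assumes "\<alpha> \<in> pos_roots"
  shows "fst \<alpha> \<ge> 0" "snd \<alpha> \<ge> 0" "\<alpha> \<noteq> 0" "snd \<alpha> \<le> fst \<alpha> + 1"
  using assms by (auto simp: pos_roots_eq pos_real_root_def root_line_def zero_prod_def)

text \<open>The unit criterion is applied in both variables: for \<alpha>_1 the outer constant
  coefficient is \<open>1 - fps_X\<close>, a unit because its own constant term is 1.\<close>

lemma root_factor_dvd_1:
  assumes "\<alpha> \<in> pos_roots"
  shows "root_factor \<alpha> dvd 1"
proof (intro fps_dvd_1I)
  have "fps_nth (fps_nth (root_factor \<alpha>) 0) 0 = 1"
    using pos_roots_nonneg[OF assms]
    by (cases \<alpha>) (auto simp: root_factor_def series_exp_nth zero_prod_def)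
  then show "fps_nth (fps_nth (root_factor \<alpha>) 0) 0 dvd 1"
    by simp
qed

lemma finite_pos_roots_fst_le: "finite {\<alpha> \<in> pos_roots. fst \<alpha> \<le> i}"
proof (rule finite_subset)
  show "{\<alpha> \<in> pos_roots. fst \<alpha> \<le> i} \<subseteq> {0..i} \<times> {0..i + 1}"
    using pos_roots_nonneg by fastforce
qed simp

text \<open>The infinite product, coefficient by coefficient: factors with larger
  \<alpha>_0-coefficient than \<open>i\<close> agree with 1 up to outer degree
  \<open>i\<close>.\<close>

definition pos_root_product :: series where
  "pos_root_product =
     Abs_fps (\<lambda>i. fps_nth (\<Prod>\<alpha> | \<alpha> \<in> pos_roots \<and> fst \<alpha> \<le> int i. root_factor \<alpha>) i)"

lemma prod_root_factor_nth:
  assumes "finite A" "A \<subseteq> pos_roots" "{\<alpha> \<in> pos_roots. fst \<alpha> \<le> int i} \<subseteq> A"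
  shows "fps_nth (prod root_factor A) i = fps_nth pos_root_product i"
  unfolding pos_root_product_def fps_nth_Abs_fps
  by (rule fps_prod_nth_subset[OF assms(1,3)]) (rule root_factor_nth, use assms(2) in auto)

lemma eventually_prod_root_factor_nth:
  "\<forall>\<^sub>F A in finite_subsets_at_top pos_roots.
     fps_nth (prod root_factor A) i = fps_nth pos_root_product i"
  unfolding eventually_finite_subsets_at_top
  by (rule exI[of _ "{\<alpha> \<in> pos_roots. fst \<alpha> \<le> int i}"])
     (auto simp: finite_pos_roots_fst_le prod_root_factor_nth)

lemma prod_root_factor_dvd_1: "A \<subseteq> pos_roots \<Longrightarrow> prod root_factor A dvd 1"
  by (intro prod_dvd_1 root_factor_dvd_1) auto

lemma pos_root_product_dvd_1: "pos_root_product dvd 1"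
proof (rule fps_dvd_1I)
  let ?A = "{\<alpha> \<in> pos_roots. fst \<alpha> \<le> int 0}"
  have "prod root_factor ?A dvd 1"
    by (rule prod_root_factor_dvd_1) auto
  then have "fps_nth (prod root_factor ?A) 0 dvd 1"
    by (metis dvdE dvd_triv_left fps_mult_nth_0 fps_one_nth)
  then show "fps_nth pos_root_product 0 dvd 1"
    by (simp add: pos_root_product_def)
qed

lemma finite_roots_at_top:
  "filterlim (finite_roots m) (finite_subsets_at_top pos_roots) sequentially"
  unfolding filterlim_finite_subsets_at_top
proof (intro allI impI)
  fix X assume X: "finite X \<and> X \<subseteq> pos_roots"
  have "\<forall>\<^sub>F n in sequentially. \<alpha> \<in> finite_roots m n" if \<alpha>: "\<alpha> \<in> pos_roots" for \<alpha>
  proof -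
    let ?k = "coset_index m"
    consider c where "\<alpha> = pos_real_root c" | i where "i \<ge> 1" "\<alpha> = (int i, int i)"
      using \<alpha> by (auto simp: pos_roots_eq)
    then show ?thesis
    proof cases
      case (1 c)
      show ?thesis
        \<comment> \<open>Both ends grow like n/2, so this bound moves them past
          \<open>c - ?k\<close>.\<close>
        using eventually_ge_at_top[of "2 * nat \<bar>c - ?k\<bar> + 2"]
      proof eventually_elim
        case (elim n)
        then have "c - ?k \<in> {lo_end n..hi_end n}"
          by (auto simp: lo_end_def hi_end_def)
        moreover have "\<alpha> = pos_real_root (?k + (c - ?k))"
          by (simp add: 1)
        ultimately show ?case
          unfolding finite_roots_def by blast
      qed
    next
      case (2 i)
      show ?thesis
        using eventually_ge_at_top[of "2 * (i + nat \<bar>?k\<bar>) + 2"]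
      proof eventually_elim
        case (elim n)
        then have "i \<in> {1..nat (?k - lo_end n)}"
          using 2 by (auto simp: lo_end_def)
        then show ?case
          unfolding finite_roots_def 2 by blast
      qed
    qed
  qed
  then have "\<forall>\<^sub>F n in sequentially. \<forall>\<alpha>\<in>X. \<alpha> \<in> finite_roots m n"
    using X by (auto simp: eventually_ball_finite_distrib)
  then show "\<forall>\<^sub>F n in sequentially.
      finite (finite_roots m n) \<and> X \<subseteq> finite_roots m n \<and> finite_roots m n \<subseteq> pos_roots"
    by eventually_elim (auto simp: finite_finite_roots finite_roots_subset[THEN subsetD])
qed

text \<open>The denominator is an infinite product, so the formula is an identity of series: as
  \<open>P\<close> is a unit, \<open>L * P = N\<close> says that \<open>L\<close> is the
  quotient.\<close>

theorem theorem7p4: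
  fixes m :: nat
  shows "\<exists>L P N.
    (\<forall>n. \<exists>F. expands_to (R m n) F) \<and>
    has_series_limit (\<lambda>n. R m n) L sequentially \<and>
    has_series_limit (\<lambda>A. \<Prod>\<alpha>\<in>A. (1 - fexp \<alpha>)) P (finite_subsets_at_top pos_roots) \<and>
    expands_to ((-1) ^ m * S (alt_word m) *
      (1 - fexp (word_prod (alt_word m) (simple_root I1)))) N \<and>
    P dvd 1 \<and> L * P = N"
proof -
  let ?k = "coset_index m" and ?P = pos_root_product
  let ?r = "(-1) ^ m * S (alt_word m) * (1 - fexp (word_prod (alt_word m) (simple_root I1)))"
  \<comment> \<open>What remains of the binomial after clearing denominators; it tends to 1.\<close>
  define G where "G n = (\<Prod>i\<in>{nat (hi_end n - ?k)<..n}. root_factor (int i, int i))" for n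
  define D where "D n = prod root_factor (finite_roots m n)" for n
  obtain U where U: "?P * U = 1"
    using pos_root_product_dvd_1 by (metis dvdE)

  have D: "expands_to (\<Prod>\<alpha>\<in>A. 1 - fexp \<alpha>) (prod root_factor A)" if "A \<subseteq> pos_roots" for A
    using that pos_roots_nonneg by (intro expands_to_prod expands_to_root_factor) auto
  have G: "expands_to (\<Prod>i\<in>{nat (hi_end n - ?k)<..n}. 1 - fexp (int i, int i)) (G n)" for n
    unfolding G_def by (intro expands_to_prod expands_to_root_factor) simp_all
  have inv_nonneg: "fst (\<Sum>i<r. inversion_root m i) \<ge> 0 \<and> snd (\<Sum>i<r. inversion_root m i) \<ge> 0" for r
    by (induction r) (auto simp: inversion_root_def)
  have "expands_to (-1) (-1)"
    using expands_to_diff[OF expands_to_0 expands_to_1] by simp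
  then have "expands_to ((-1) ^ m) ((-1) ^ m)"
    using expands_to_prod[of "{..<m}" "\<lambda>_. -1" "\<lambda>_. -1"] by simp
  then obtain N where N: "expands_to ?r N"
    using expands_to_mult[OF expands_to_mult
        [OF _ expands_to_fexp] expands_to_root_factor] inv_nonneg[of m]
    unfolding S_alt_word word_prod_alt_word
    by (metis (no_types, lifting) fst_conv inversion_root_def of_nat_0_le_iff snd_conv
        add_nonneg_nonneg zero_le_one)

  have R: "\<exists>F. expands_to (R m n) F \<and>
      (?k \<in> {lo_end n..hi_end n} \<longrightarrow> F * D n = N * G n)" for n
  proof (cases "?k \<in> {lo_end n..hi_end n}")
    case False
    then show ?thesis
      using R_eq_0 expands_to_0 by metis
  next
    case True
    let ?d = "\<Prod>\<alpha>\<in>finite_roots m n. 1 - fexp \<alpha>"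
    obtain V where V: "D n * V = 1"
      using prod_root_factor_dvd_1[OF finite_roots_subset] unfolding D_def by (metis dvdE)
    have "?d \<noteq> 0"
      using finite_roots_subset pos_roots_nonneg(3) by (fastforce simp: finite_finite_roots)
    then have "R m n = (R m n * ?d) * inverse ?d"
      by simp
    moreover have "expands_to (R m n * ?d) (N * G n)"
      unfolding R_mult_prod_finite_roots[OF True] by (intro expands_to_mult N G)
    moreover have "expands_to (inverse ?d) V"
      by (rule expands_to_inverse[OF D[OF finite_roots_subset]]) (use V in \<open>simp add: D_def\<close>)
    ultimately have "expands_to (R m n) (N * G n * V)"
      using expands_to_mult by metis
    moreover have "N * G n * V * D n = N * G n"
      using V by (simp add: mult_ac)
    ultimately show ?thesis by blast
  qed
  then obtain F where F: "\<And>n. expands_to (R m n) (F n)"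
    "\<And>n. ?k \<in> {lo_end n..hi_end n} \<Longrightarrow> F n * D n = N * G n"
    by metis

  have lim: "\<forall>\<^sub>F n in sequentially. fps_nth (F n) i = fps_nth (N * U) i" for i
  proof -
    have "\<forall>\<^sub>F n in sequentially. \<forall>j\<in>{..i}. fps_nth (D n) j = fps_nth ?P j"
      unfolding D_def
      by (intro eventually_ball_finite ballI finite_atMost
          eventually_compose_filterlim[OF eventually_prod_root_factor_nth finite_roots_at_top])
    \<comment> \<open>This bound puts \<open>?k\<close> into the interval and leaves in
      \<open>G n\<close> only factors that are 1 up to outer degree \<open>i\<close>.\<close>
    moreover have "\<forall>\<^sub>F n in sequentially. n \<ge> 2 * (i + nat \<bar>?k\<bar>) + 2"
      by (rule eventually_ge_at_top)
    ultimately show ?thesis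
    proof eventually_elim
      case (elim n)
      then have k: "?k \<in> {lo_end n..hi_end n}" and i: "i \<le> nat (hi_end n - ?k)"
        by (auto simp: lo_end_def hi_end_def)
      have G1: "fps_nth (G n) j = fps_nth 1 j" if "j \<le> i" for j
        unfolding G_def using that
        by (rule fps_prod_nth_eq_1[rotated]) (rule root_factor_nth, use i in auto)
      have "fps_nth (D n * U) j = fps_nth (?P * U) j" if "j \<le> i" for j
        by (rule fps_mult_nth_cong) (use elim that in auto)
      \<comment> \<open>Up to degree \<open>i\<close> the series \<open>D n * U\<close> equals 1.
        Inserting it brings in the product \<open>F n * D n\<close>, which is known.\<close>
      then have "fps_nth (F n * 1) i = fps_nth (F n * (D n * U)) i"
        by (intro fps_mult_nth_cong) (simp_all add: U)
      also have "\<dots> = fps_nth (N * U * G n) i"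
        using F(2)[OF k] by (metis mult.assoc mult.commute)
      also have "\<dots> = fps_nth (N * U * 1) i"
        by (intro fps_mult_nth_cong) (simp_all add: G1)
      finally show ?case by simp
    qed
  qed
  have "has_series_limit (\<lambda>n. R m n) (N * U) sequentially"
    unfolding has_series_limit_def
  proof (intro exI[of _ F] conjI allI)
    show "\<forall>\<^sub>F n in sequentially. fps_nth (fps_nth (F n) i) j = fps_nth (fps_nth (N * U) i) j" for i j
      using lim[of i] by eventually_elim simp
  qed (simp add: F(1))
  moreover have "has_series_limit (\<lambda>A. \<Prod>\<alpha>\<in>A. (1 - fexp \<alpha>)) ?P (finite_subsets_at_top pos_roots)"
    unfolding has_series_limit_def
  proof (intro exI[of _ "prod root_factor"] conjI allI)
    show "\<forall>\<^sub>F A in finite_subsets_at_top pos_roots.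
        expands_to (\<Prod>\<alpha>\<in>A. 1 - fexp \<alpha>) (prod root_factor A)"
      by (rule eventually_finite_subsets_at_top_weakI) (rule D)
    show "\<forall>\<^sub>F A in finite_subsets_at_top pos_roots.
        fps_nth (fps_nth (prod root_factor A) i) j = fps_nth (fps_nth ?P i) j" for i j
      using eventually_prod_root_factor_nth[of i] by eventually_elim simp
  qed
  moreover have "N * U * ?P = N"
    using U by (simp add: mult_ac)
  ultimately show ?thesis
    using F(1) N pos_root_product_dvd_1 by blast
qed

end
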